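(* For every integer $g\ge 0$, let $S^g=\big((a^g_n,b^g_n)\big)_{n\ge 0}$ be the $g$-sequence of 2-Star Nim. Then the sequence $(b^g_n-a^g_n)_{n\ge 0}$ is ultimately periodic.
   Context: 2-Star Nim: a position is a pair $(a,b)$ of nonnegative integers, not both $0$ (one token on square $a$ of a first strip and one on square $b$ of a second strip, the two strips sharing their square $0$, which holds at most one token). A move replaces exactly one coordinate by a smaller nonnegative integer, provided the result is not $(0,0)$. A player unable to move loses. $\mathcal{G}(a,b)$ is the Sprague-Grundy value, $\mathcal{G}(p)=\operatorname{mex}\{\mathcal{G}(q): q\text{ reachable from }p\text{ in one move}\}$, where $\operatorname{mex}(S)$ is the least nonnegative integer not in $S$. It is symmetric in $a,b$. The $g$-sequence $S^g=\big((a^g_0,b^g_0),(a^g_1,b^g_1),\ldots\big)$ lists all positions $(a,b)$ with $a\le b$ and $\mathcal{G}(a,b)=g$, ordered so that $a^g_i<a^g_j$ whenever $i<j$ (it is an infinite sequence). A sequence $(s_n)_{n\ge0}$ is ultimately periodic if there exist $n_0\ge 0$ and $p\ge1$ such that $s_{n+p}=s_n$ for all $n\ge n_0$. *)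

theory Defs
  imports Main "HOL-Library.Infinite_Set"
begin

definition mex :: "nat set \<Rightarrow> nat" where
  "mex S = (LEAST n. n \<notin> S)"

text \<open>The pair (0,0) is not a position of 2-Star Nim. The functions below are total on
  pairs, so it is excluded explicitly, both as the target of a move and in \<open>g_positions\<close>.\<close>

definition positions :: "(nat \<times> nat) set" where
  "positions = - {(0, 0)}"

definition moves :: "nat \<times> nat \<Rightarrow> (nat \<times> nat) set" where
  "moves p = {q \<in> positions. (fst q < fst p \<and> snd q = snd p) \<or> (fst q = fst p \<and> snd q < snd p)}"

function grundy :: "nat \<times> nat \<Rightarrow> nat" where
  "grundy p = mex (grundy ` moves p)"
  by auto
termination
  by (relation "Wellfounded.measure (\<lambda>p. fst p + snd p)") (auto simp: moves_def)

declare grundy.simps [simp del]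

definition g_positions :: "nat \<Rightarrow> (nat \<times> nat) set" where
  "g_positions g = {(a, b) \<in> positions. a \<le> b \<and> grundy (a, b) = g}"

definition is_g_sequence :: "nat \<Rightarrow> (nat \<Rightarrow> nat \<times> nat) \<Rightarrow> bool" where
  "is_g_sequence g S \<longleftrightarrow> strict_mono (\<lambda>n. fst (S n)) \<and> range S = g_positions g"

definition g_sequence :: "nat \<Rightarrow> nat \<Rightarrow> nat \<times> nat" where
  "g_sequence g = (THE S. is_g_sequence g S)"

definition ultimately_periodic :: "(nat \<Rightarrow> 'a) \<Rightarrow> bool" where
  "ultimately_periodic s \<longleftrightarrow> (\<exists>n0. \<exists>p\<ge>1. \<forall>n\<ge>n0. s (n + p) = s n)"

text \<open>The remaining facts show that the definite description in \<open>g_sequence_def\<close> is proper.\<close>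

lemma finite_moves: "finite (moves p)"
proof -
  have "moves p \<subseteq> {..fst p} \<times> {..snd p}"
    by (auto simp: moves_def)
  then show ?thesis
    by (rule finite_subset) simp
qed

lemma mex_notin: "finite S \<Longrightarrow> mex S \<notin> S"
  unfolding mex_def by (rule LeastI_ex) (rule ex_new_if_finite[OF infinite_UNIV_nat])

lemma less_mex_in: "n < mex S \<Longrightarrow> n \<in> S"
  unfolding mex_def using not_less_Least by blast

lemma grundy_move: "q \<in> moves p \<Longrightarrow> grundy q \<noteq> grundy p"
  by (subst (2) grundy.simps) (metis finite_imageI finite_moves imageI mex_notin)

lemma grundy_less:
  assumes "n < grundy p"
  shows "\<exists>q\<in>moves p. grundy q = n"
proof -
  have "n < mex (grundy ` moves p)"
    using assms by (subst (asm) grundy.simps)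
  from less_mex_in[OF this] show ?thesis by blast
qed

lemma moves_swap: "moves (prod.swap p) = prod.swap ` moves p"
proof -
  have "q \<in> moves (prod.swap p) \<longleftrightarrow> prod.swap q \<in> moves p" for q
    by (cases q; cases p) (auto simp: moves_def positions_def)
  then show ?thesis
    by (force intro: image_eqI[of _ _ "prod.swap _"])
qed

lemma grundy_swap: "grundy (prod.swap p) = grundy p"
proof (induction p rule: grundy.induct)
  case (1 p)
  have "grundy ` moves (prod.swap p) = grundy ` moves p"
    unfolding moves_swap image_image using 1 by (auto intro!: image_cong)
  then show ?case
    by (subst (1 2) grundy.simps) (rule arg_cong)
qed

lemma grundy_row_inj:
  assumes "(a, b) \<in> positions" "(a, c) \<in> positions" "grundy (a, b) = grundy (a, c)"
  shows "b = c"
proof (rule ccontr)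
  assume "b \<noteq> c"
  then have "(a, b) \<in> moves (a, c) \<or> (a, c) \<in> moves (a, b)"
    using assms by (auto simp: moves_def)
  then show False
    using grundy_move assms by metis
qed

lemma grundy_row_ex: "\<exists>b. (a, b) \<in> positions \<and> grundy (a, b) = g"
proof (rule ccontr)
  assume none: "\<not> ?thesis"
  let ?f = "\<lambda>b. grundy (a, b)"
  have inj: "inj_on ?f {1..}"
    by (rule inj_onI, rule grundy_row_inj[of a]) (simp_all add: positions_def)
  have fin1: "finite {b \<in> {1..}. ?f b < g}"
    using finite_vimage_IntI[OF finite_lessThan[of g] inj]
    by (rule finite_subset[rotated]) auto
  have fin2: "finite {b \<in> {1..}. grundy (a', b) = g}" for a'
  proof (cases "\<exists>b\<ge>1. grundy (a', b) = g")
    case True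
    then obtain b where "b \<ge> 1" "grundy (a', b) = g" by blast
    then have "{b \<in> {1..}. grundy (a', b) = g} \<subseteq> {b}"
      using grundy_row_inj[of a' _ b] by (auto simp: positions_def)
    then show ?thesis by (rule finite_subset) simp
  qed (auto intro: finite_subset[of _ "{}"])
  have "finite ({b \<in> {1..}. ?f b < g} \<union> (\<Union>a'<a. {b \<in> {1..}. grundy (a', b) = g}) \<union> {0})"
    using fin1 fin2 by auto
  from ex_new_if_finite[OF infinite_UNIV_nat this]
  obtain b where "b \<notin> {b \<in> {1..}. ?f b < g} \<union> (\<Union>a'<a. {b \<in> {1..}. grundy (a', b) = g}) \<union> {0}"
    by blast
  then have b: "b \<ge> 1" "\<not> ?f b < g" "a' < a \<Longrightarrow> grundy (a', b) \<noteq> g" for a'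
    by auto
  have "(a, b) \<in> positions"
    using b(1) by (simp add: positions_def)
  then have "?f b \<noteq> g"
    using none by blast
  with b have "g < ?f b" by simp
  from grundy_less[OF this] obtain q where q: "q \<in> moves (a, b)" "grundy q = g"
    by blast
  obtain x y where xy: "q = (x, y)"
    by (cases q)
  with q(1) consider "x < a" "y = b" | "x = a" "(a, y) \<in> positions"
    by (auto simp: moves_def)
  then show False
    using b(3)[of x] none q(2) xy by cases auto
qed

lemma inj_on_fst_g_positions: "inj_on fst (g_positions g)"
  by (rule inj_onI) (force simp: g_positions_def dest: grundy_row_inj)

lemma infinite_g_positions: "infinite (g_positions g)"
proof
  assume fin: "finite (g_positions g)"
  have "a \<in> fst ` g_positions g \<union> snd ` g_positions g" for a
  proof -
    obtain b where b: "(a, b) \<in> positions" "grundy (a, b) = g"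
      using grundy_row_ex by blast
    then have "(a, b) \<in> g_positions g \<or> (b, a) \<in> g_positions g"
      using grundy_swap[of "(a, b)"] by (auto simp: g_positions_def positions_def)
    then show ?thesis by force
  qed
  then have "UNIV = fst ` g_positions g \<union> snd ` g_positions g" by blast
  then show False
    using fin infinite_UNIV_nat by (metis finite_UnI finite_imageI)
qed

lemma strict_mono_range_le:
  fixes f h :: "nat \<Rightarrow> nat"
  assumes f: "strict_mono f" and h: "strict_mono h" and r: "range f = range h"
    and less: "\<And>m. m < n \<Longrightarrow> f m = h m"
  shows "h n \<le> f n"
proof -
  obtain m where m: "f n = h m"
    using r by (metis rangeE rangeI)
  have "\<not> m < n"
    using m less[of m] strict_mono_less[OF f, of m n] by auto
  then show ?thesis
    unfolding m using strict_mono_less_eq[OF h] by auto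
qed

lemma strict_mono_range_unique:
  fixes f h :: "nat \<Rightarrow> nat"
  assumes "strict_mono f" "strict_mono h" "range f = range h"
  shows "f = h"
proof
  show "f n = h n" for n
  proof (induction n rule: less_induct)
    case (less n)
    then show ?case
      using strict_mono_range_le[OF assms, of n] strict_mono_range_le[OF assms(2,1), of n] assms(3)
      by (simp add: order_antisym)
  qed
qed

lemma is_g_sequence_unique:
  assumes "is_g_sequence g S" "is_g_sequence g T"
  shows "S = T"
proof -
  have "range (\<lambda>n. fst (R n)) = fst ` g_positions g" if "is_g_sequence g R" for R
    using that unfolding is_g_sequence_def by (metis image_image)
  then have eq: "(\<lambda>n. fst (S n)) = (\<lambda>n. fst (T n))"
    using assms by (intro strict_mono_range_unique) (auto simp: is_g_sequence_def)
  show ?thesis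
  proof
    fix n
    have "fst (S n) = fst (T n)"
      using eq by (rule fun_cong)
    moreover have "S n \<in> g_positions g" "T n \<in> g_positions g"
      using assms by (auto simp: is_g_sequence_def)
    ultimately show "S n = T n"
      by (rule inj_onD[OF inj_on_fst_g_positions])
  qed
qed

lemma is_g_sequence_ex: "\<exists>S. is_g_sequence g S"
proof -
  let ?A = "fst ` g_positions g"
  let ?S = "\<lambda>n. the_inv_into (g_positions g) fst (enumerate ?A n)"
  have inf: "infinite ?A"
    using finite_imageD[OF _ inj_on_fst_g_positions] infinite_g_positions by blast
  have "fst (?S n) = enumerate ?A n" for n
    by (intro f_the_inv_into_f inj_on_fst_g_positions enumerate_in_set inf)
  moreover have "range ?S = the_inv_into (g_positions g) fst ` ?A"
    using range_enumerate[OF inf] by (metis image_image)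
  ultimately have "is_g_sequence g ?S"
    using strict_mono_enumerate[OF inf] the_inv_into_onto[OF inj_on_fst_g_positions]
    by (simp add: is_g_sequence_def)
  then show ?thesis by blast
qed

lemma is_g_sequence_g_sequence: "is_g_sequence g (g_sequence g)"
  unfolding g_sequence_def using is_g_sequence_ex is_g_sequence_unique by (metis theI)

end

theory Submission
  imports Defs
begin

text \<open>
  Fix \<open>g\<close>. In row \<open>a\<close> let \<open>b \<ge> a\<close> be the column of value \<open>g\<close>. Apart from at most \<open>g + 1\<close>
  exceptions, every column \<open>c \<in> {a..<b}\<close> is passed over because it already carries the value
  \<open>g\<close> in a row above \<open>a\<close>. Looking at the topmost of these rows, the symmetry of the table shows that
  the rows so obtained are themselves exceptions for that topmost row, so there are at most
  \<open>g + 1\<close> of them as well. Hence positions of value at most \<open>g\<close> lie in a diagonal band of bounded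
  width. Inside the band the table is computed from a bounded window that slides along the
  diagonal; there are finitely many window contents, so one of them recurs, and from then on
  the pattern of values at most \<open>g\<close> is invariant under a diagonal shift.
\<close>

section \<open>The mex recursion as a relation between rows and columns\<close>

text \<open>Membership in \<open>positions\<close> is demanded because the total function
  \<open>grundy\<close> gives (0, 0) the value 0. Unlike \<open>g_positions\<close>, both sides of
  the diagonal count, so the relation is symmetric.\<close>

definition has_value :: "nat \<Rightarrow> nat \<Rightarrow> nat \<Rightarrow> bool" where
  "has_value g a b \<longleftrightarrow> (a, b) \<in> positions \<and> grundy (a, b) = g"

lemma has_value_row_inj: "has_value g a b \<Longrightarrow> has_value g a c \<Longrightarrow> b = c"
  unfolding has_value_def using grundy_row_inj by metis

lemma has_value_sym: "has_value g a b \<longleftrightarrow> has_value g b a"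
  using grundy_swap[of "(a, b)"] by (auto simp: has_value_def positions_def)

lemma has_value_column_inj: "has_value g a c \<Longrightarrow> has_value g b c \<Longrightarrow> a = b"
  using has_value_row_inj has_value_sym by metis

lemma ex_move_has_value:
  "(\<exists>q\<in>moves (a, b). grundy q = g) \<longleftrightarrow> (\<exists>x<a. has_value g x b) \<or> (\<exists>y<b. has_value g a y)"
  by (force simp: moves_def has_value_def)

text \<open>The right-hand side mentions only values up to \<open>g\<close>, so these form a closed
  system that can be computed without knowing any larger value.\<close>

lemma has_value_iff:
  "has_value g a b \<longleftrightarrow> (a, b) \<noteq> (0, 0)
     \<and> (\<forall>h<g. (\<exists>x<a. has_value h x b) \<or> (\<exists>y<b. has_value h a y))
     \<and> \<not> ((\<exists>x<a. has_value g x b) \<or> (\<exists>y<b. has_value g a y))"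
proof -
  have "grundy (a, b) = g \<longleftrightarrow> (\<forall>h<g. \<exists>q\<in>moves (a, b). grundy q = h) \<and> \<not> (\<exists>q\<in>moves (a, b). grundy q = g)"
    using grundy_move grundy_less by (metis linorder_neqE_nat)
  then show ?thesis
    unfolding ex_move_has_value[symmetric] by (simp add: has_value_def positions_def)
qed

section \<open>The diagonal band\<close>

text \<open>In such a column \<open>c\<close> no move from (a, c) reaches \<open>g\<close>, and
  \<open>g\<close> itself is attained only at \<open>b\<close>; so the mex is below
  \<open>g\<close>, and each smaller value occurs only once in the row.\<close>

lemma card_columns_skipped_le:
  assumes "has_value g a b"
  shows "card {c \<in> {a..<b}. \<not> (\<exists>x<a. has_value g x c)} \<le> g + 1"
proof -
  let ?col = "\<lambda>h. THE c. has_value h a c"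
  \<comment> \<open>The extra 0 accounts for column 0 of row 0, which is not a position.\<close>
  have "{c \<in> {a..<b}. \<not> (\<exists>x<a. has_value g x c)} \<subseteq> insert 0 (?col ` {..<g})"
  proof
    fix c assume c: "c \<in> {c \<in> {a..<b}. \<not> (\<exists>x<a. has_value g x c)}"
    show "c \<in> insert 0 (?col ` {..<g})"
    proof (cases "(a, c) \<in> positions")
      case True
      then have v: "has_value (grundy (a, c)) a c"
        by (simp add: has_value_def)
      have "\<not> (\<exists>x<a. has_value g x c)" "\<not> (\<exists>y<c. has_value g a y)" "\<not> has_value g a c"
        using c has_value_row_inj[OF assms] by force+
      then have "grundy (a, c) < g"
        using v has_value_iff[of "grundy (a, c)" a c] by (metis linorder_neqE_nat)
      moreover have "?col (grundy (a, c)) = c"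
        using v has_value_row_inj by blast
      ultimately show ?thesis by force
    qed (simp add: positions_def)
  qed
  then have "card {c \<in> {a..<b}. \<not> (\<exists>x<a. has_value g x c)} \<le> card (insert 0 (?col ` {..<g}))"
    by (intro card_mono) auto
  also have "\<dots> \<le> Suc (card (?col ` {..<g}))"
    by (rule card_insert_le_m1) simp_all
  also have "\<dots> \<le> g + 1"
    using card_image_le[of "{..<g}" ?col] by simp
  finally show ?thesis .
qed

lemma has_value_band:
  assumes "has_value g a b"
  shows "b \<le> a + (2 * g + 2)"
proof -
  define S where "S = {c \<in> {a..<b}. \<exists>x<a. has_value g x c}"
  define row where "row c = (THE x. has_value g x c)" for c
  have row: "has_value g (row c) c" "row c < a" if c: "c \<in> S" for c
  proof -
    obtain x where x: "x < a" "has_value g x c"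
      using c by (auto simp: S_def)
    then have "row c = x"
      unfolding row_def using has_value_column_inj by blast
    with x show "has_value g (row c) c" "row c < a" by simp_all
  qed
  have "card S \<le> g + 1"
  proof (cases "S = {}")
    case False
    define m where "m = Min (row ` S)"
    have fin: "finite (row ` S)" by (simp add: S_def)
    then have "m \<in> row ` S"
      unfolding m_def using False by (intro Min_in) auto
    then obtain d where d: "d \<in> S" "m = row d" by blast
    let ?E = "{c \<in> {m..<d}. \<not> (\<exists>x<m. has_value g x c)}"
    have "row ` S \<subseteq> ?E"
    proof
      fix r assume r: "r \<in> row ` S"
      then obtain c where c: "c \<in> S" "r = row c" by blast
      have "m \<le> r" unfolding m_def using fin r by (rule Min_le)
      moreover have "r < d" using row(2)[OF c(1)] c(2) d(1) by (auto simp: S_def)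
      \<comment> \<open>By symmetry, column \<open>r\<close> carries \<open>g\<close> only in row
        \<open>c\<close>, and \<open>c\<close> \<ge> \<open>a\<close> > \<open>m\<close>.\<close>
      moreover have "x \<ge> m" if "has_value g x r" for x
      proof -
        have "has_value g c r"
          using row(1)[OF c(1)] c(2) has_value_sym by simp
        then have "x = c" using that has_value_column_inj by blast
        then show ?thesis using c(1) row(2)[OF d(1)] d(2) by (simp add: S_def)
      qed
      ultimately show "r \<in> ?E" by force
    qed
    then have "card (row ` S) \<le> card ?E" by (intro card_mono) auto
    also have "\<dots> \<le> g + 1"
      using card_columns_skipped_le row(1)[OF d(1)] d(2) by simp
    finally have "card (row ` S) \<le> g + 1" .
    moreover have "inj_on row S"
      using row(1) has_value_row_inj by (intro inj_onI) metis
    ultimately show ?thesis by (simp add: card_image)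
  qed simp
  moreover have "{a..<b} = S \<union> {c \<in> {a..<b}. \<not> (\<exists>x<a. has_value g x c)}"
    by (auto simp: S_def)
  then have "card {a..<b} \<le> card S + card {c \<in> {a..<b}. \<not> (\<exists>x<a. has_value g x c)}"
    using card_Un_le by metis
  ultimately show ?thesis
    using card_columns_skipped_le[OF assms] by simp
qed

section \<open>Invariance under a diagonal shift\<close>

text \<open>The band forces every witness in column \<open>b\<close> to lie at row \<open>n\<close>
  or below, and every witness in column \<open>b + p\<close> at row \<open>n + p\<close> or below,
  so nothing is needed about the rows before \<open>n\<close>.\<close>

lemma ex_has_value_shift:
  assumes band: "\<And>x y. has_value h x y \<Longrightarrow> y \<le> x + K"
    and b: "n + K \<le> b"
    and step: "\<And>x. n \<le> x \<Longrightarrow> x < a \<Longrightarrow> has_value h x b \<longleftrightarrow> has_value h (x + p) (b + p)"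
  shows "(\<exists>x<a. has_value h x b) \<longleftrightarrow> (\<exists>x<a + p. has_value h x (b + p))"
proof
  assume "\<exists>x<a. has_value h x b"
  then obtain x where x: "x < a" "has_value h x b" by blast
  then have "n \<le> x" using band[OF x(2)] b by simp
  then show "\<exists>x<a + p. has_value h x (b + p)"
    using x step by (metis add_less_cancel_right)
next
  assume "\<exists>x<a + p. has_value h x (b + p)"
  then obtain x where x: "x < a + p" "has_value h x (b + p)" by blast
  then have "n + p \<le> x" using band[OF x(2)] b by simp
  then have "x = (x - p) + p" "n \<le> x - p" "x - p < a" using x(1) by auto
  then show "\<exists>x<a. has_value h x b"
    using x step by metis
qed

text \<open>The hypothesis \<open>1 \<le> n\<close> keeps the excluded position \<open>(0, 0)\<close> out of the window.\<close>

lemma has_value_shift: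
  assumes band: "\<And>h x y. h \<le> g \<Longrightarrow> has_value h x y \<Longrightarrow> y \<le> x + K"
    and n: "1 \<le> n"
    and window: "\<And>h i j. h \<le> g \<Longrightarrow> i < 2 * K \<Longrightarrow> j < 2 * K
      \<Longrightarrow> has_value h (n + i) (n + j) \<longleftrightarrow> has_value h (n + i + p) (n + j + p)"
    and "h \<le> g" "n \<le> x" "n \<le> y"
  shows "has_value h x y \<longleftrightarrow> has_value h (x + p) (y + p)"
  using assms(4-6)
proof (induction "x + y" arbitrary: h x y rule: less_induct)
  case less
  \<comment> \<open>A cell of the band with one coordinate at least \<open>n + 2 * K\<close> has the
    other at least \<open>n + K\<close>; hence the window size \<open>2 * K\<close>.\<close>
  consider "x < n + 2 * K" "y < n + 2 * K" | "y > x + K \<or> x > y + K"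
    | "n + K \<le> x" "n + K \<le> y"
    by linarith
  then show ?case
  proof cases
    case 1
    then show ?thesis
      using window[of h "x - n" "y - n"] less.prems by simp
  next
    case 2
    then have "\<not> has_value h x y" "\<not> has_value h (x + p) (y + p)"
      using band[OF less.prems(1)] has_value_sym by fastforce+
    then show ?thesis by simp
  next
    case 3
    have col: "(\<exists>x'<x. has_value k x' y) \<longleftrightarrow> (\<exists>x'<x + p. has_value k x' (y + p))" if "k \<le> g" for k
      by (rule ex_has_value_shift[where K = K and n = n])
        (use that less 3 band in auto)
    \<comment> \<open>The search along a row is transposed into a search along a column, so that the
      same lemma applies.\<close>
    have "(\<exists>y'<y. has_value k y' x) \<longleftrightarrow> (\<exists>y'<y + p. has_value k y' (x + p))" if "k \<le> g" for k
    proof (rule ex_has_value_shift[where K = K and n = n])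
      fix y' assume "n \<le> y'" "y' < y"
      then show "has_value k y' x \<longleftrightarrow> has_value k (y' + p) (x + p)"
        using less.hyps[of x y' k] less.prems that has_value_sym by simp
    qed (use that 3 band in auto)
    then have row: "(\<exists>y'<y. has_value k x y') \<longleftrightarrow> (\<exists>y'<y + p. has_value k (x + p) y')" if "k \<le> g" for k
      using that has_value_sym by metis
    have "(x, y) \<noteq> (0, 0)" "(x + p, y + p) \<noteq> (0, 0)"
      using n less.prems by auto
    moreover have "k \<le> g" if "k < h" for k
      using that less.prems(1) by simp
    ultimately show ?thesis
      unfolding has_value_iff[of h x y] has_value_iff[of h "x + p" "y + p"]
      using less.prems(1) by (simp add: col row)
  qed
qed

lemma has_value_ultimately_shift_invariant:
  obtains n p where "1 \<le> p"
    "\<And>x y. n \<le> x \<Longrightarrow> n \<le> y \<Longrightarrow> has_value g x y \<longleftrightarrow> has_value g (x + p) (y + p)"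
proof -
  \<comment> \<open>The band width for \<open>g\<close> also serves all smaller values.\<close>
  define K where "K = 2 * g + 2"
  define W where "W n = {(h, i, j) \<in> {..g} \<times> {..<2 * K} \<times> {..<2 * K}. has_value h (n + i) (n + j)}" for n
  have "range W \<subseteq> Pow ({..g} \<times> {..<2 * K} \<times> {..<2 * K})"
    by (auto simp: W_def)
  then have "finite (W ` {1..})"
    by (meson finite_Pow_iff finite_SigmaI finite_atMost finite_lessThan finite_subset image_mono
        subset_UNIV subset_trans)
  \<comment> \<open>Pigeonhole: two windows at different places have equal contents, and their
    distance is the shift \<open>p\<close>.\<close>
  then have "\<not> inj_on W {1..}"
    using finite_imageD infinite_Ici by blast
  then obtain n m where "1 \<le> n" "n < m" "W n = W m"
    unfolding inj_on_def by (metis atLeast_iff linorder_neqE_nat)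
  then obtain p where n: "1 \<le> n" and p: "1 \<le> p" and W: "W n = W (n + p)"
    by (metis One_nat_def Suc_leI less_imp_add_positive)
  have "has_value g x y \<longleftrightarrow> has_value g (x + p) (y + p)" if "n \<le> x" "n \<le> y" for x y
  proof (rule has_value_shift[where K = K and g = g and n = n])
    fix h x y assume "h \<le> g" "has_value h x y"
    then show "y \<le> x + K"
      using has_value_band[of h x y] by (simp add: K_def)
  next
    fix h i j assume "h \<le> g" "i < 2 * K" "j < 2 * K"
    then have "has_value h (n + i) (n + j) \<longleftrightarrow> (h, i, j) \<in> W n"
      "has_value h (n + i + p) (n + j + p) \<longleftrightarrow> (h, i, j) \<in> W (n + p)"
      by (simp_all add: W_def ac_simps)
    then show "has_value h (n + i) (n + j) \<longleftrightarrow> has_value h (n + i + p) (n + j + p)"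
      using W by simp
  qed (use n that in auto)
  with p show ?thesis using that by blast
qed

section \<open>From a periodic range to a periodic enumeration\<close>

lemma range_strict_mono_shift:
  fixes f :: "nat \<Rightarrow> nat"
  assumes "strict_mono f"
  shows "range (\<lambda>n. f (N + n)) = {a \<in> range f. f N \<le> a}"
proof -
  have "f k \<in> range (\<lambda>n. f (N + n))" if "f N \<le> f k" for k
    using that strict_mono_less_eq[OF assms] by (metis le_Suc_ex rangeI)
  then show ?thesis
    using strict_mono_less_eq[OF assms] by auto
qed

text \<open>Here \<open>q\<close> counts the elements of the range in a stretch of length
  \<open>p\<close> from \<open>f n0\<close>. Both sides, as sequences from \<open>n0\<close> on,
  enumerate increasingly the elements of the range that are at least
  \<open>f n0 + p\<close>.\<close>

lemma strict_mono_periodic_range: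
  fixes f :: "nat \<Rightarrow> nat"
  assumes f: "strict_mono f" and p: "1 \<le> p"
    and per: "\<And>a. n0 \<le> a \<Longrightarrow> a + p \<in> range f \<longleftrightarrow> a \<in> range f"
  obtains q where "1 \<le> q" "\<And>n. n0 \<le> n \<Longrightarrow> f (n + q) = f n + p"
proof -
  \<comment> \<open>Thus the threshold \<open>n0\<close> for values also works for indices.\<close>
  have ge: "n0 \<le> f n0"
    by (rule strict_mono_imp_increasing[OF f])
  then have "f n0 + p \<in> range f" using per by simp
  then obtain k where k: "f k = f n0 + p" by (metis rangeE)
  then have "n0 < k" using p strict_mono_less[OF f, of n0 k] by simp
  then obtain q where q: "1 \<le> q" "k = n0 + q"
    by (metis One_nat_def Suc_leI less_imp_add_positive)
  have "(\<lambda>n. f (k + n)) = (\<lambda>n. f (n0 + n) + p)"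
  proof (rule strict_mono_range_unique)
    show "strict_mono (\<lambda>n. f (k + n))" "strict_mono (\<lambda>n. f (n0 + n) + p)"
      using f by (simp_all add: strict_mono_def)
    have "range (\<lambda>n. f (n0 + n) + p) = (\<lambda>a. a + p) ` {a \<in> range f. f n0 \<le> a}"
      unfolding range_strict_mono_shift[OF f, symmetric] by (simp add: image_image)
    also have "\<dots> = {a \<in> range f. f n0 + p \<le> a}"
    proof (intro equalityI subsetI)
      fix a assume "a \<in> {a \<in> range f. f n0 + p \<le> a}"
      then have "a - p \<in> {a \<in> range f. f n0 \<le> a}" "a = (a - p) + p"
        using per[of "a - p"] ge by auto
      then show "a \<in> (\<lambda>a. a + p) ` {a \<in> range f. f n0 \<le> a}" by blast
    qed (use per ge in auto)
    finally show "range (\<lambda>n. f (k + n)) = range (\<lambda>n. f (n0 + n) + p)"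
      using range_strict_mono_shift[OF f, of k] k by simp
  qed
  then have eq: "f (k + i) = f (n0 + i) + p" for i
    by (rule fun_cong)
  have "f (n + q) = f n + p" if "n0 \<le> n" for n
    using eq[of "n - n0"] that q(2) by (simp add: ac_simps)
  with q(1) show ?thesis using that by blast
qed

theorem theorem4:
  fixes g :: nat
  shows "ultimately_periodic (\<lambda>n. int (snd (g_sequence g n)) - int (fst (g_sequence g n)))"
proof -
  define S where "S = g_sequence g"
  define f where "f n = fst (S n)" for n
  have mono: "strict_mono f" and rS: "range S = g_positions g"
    using is_g_sequence_g_sequence[of g] by (simp_all add: is_g_sequence_def S_def f_def[abs_def])
  obtain n0 p where p: "1 \<le> p"
    and shift: "\<And>x y. n0 \<le> x \<Longrightarrow> n0 \<le> y \<Longrightarrow> has_value g x y \<longleftrightarrow> has_value g (x + p) (y + p)"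
    by (rule has_value_ultimately_shift_invariant[where g = g]) (rule that)
  have S: "f n \<le> snd (S n)" "has_value g (f n) (snd (S n))" for n
  proof -
    have "S n \<in> g_positions g" using rS by blast
    then show "f n \<le> snd (S n)" "has_value g (f n) (snd (S n))"
      by (auto simp: f_def g_positions_def has_value_def)
  qed
  have "range f = Domain (g_positions g)"
    unfolding rS[symmetric] f_def fst_eq_Domain[symmetric] by (simp add: image_image)
  \<comment> \<open>Membership in \<open>range f\<close> is a condition invariant under the diagonal
    shift, so the range is eventually periodic.\<close>
  then have rf: "a \<in> range f \<longleftrightarrow> (\<exists>b\<ge>a. has_value g a b)" for a
    unfolding g_positions_def has_value_def by (simp only: Domain_iff) auto
  have "a + p \<in> range f \<longleftrightarrow> a \<in> range f" if "n0 \<le> a" for a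
  proof
    assume "a + p \<in> range f"
    then obtain b where "a + p \<le> b" "has_value g (a + p) b" using rf by blast
    then have "a \<le> b - p" "has_value g a (b - p)"
      using shift[of a "b - p"] that by auto
    then show "a \<in> range f" using rf by blast
  next
    assume "a \<in> range f"
    then obtain b where "a \<le> b" "has_value g a b" using rf by blast
    then have "a + p \<le> b + p" "has_value g (a + p) (b + p)"
      using shift[of a b] that by auto
    then show "a + p \<in> range f" using rf by blast
  qed
  then obtain q where q: "1 \<le> q" "\<And>n. n0 \<le> n \<Longrightarrow> f (n + q) = f n + p"
    using strict_mono_periodic_range[OF mono p, of n0] by blast
  have "int (snd (S (n + q))) - int (fst (S (n + q))) = int (snd (S n)) - int (fst (S n))"
    if n: "n0 \<le> n" for n
  proof -
    have "n0 \<le> f n" using strict_mono_imp_increasing[OF mono, of n] n by simp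
    then have "has_value g (f n + p) (snd (S n) + p)"
      using shift[of "f n" "snd (S n)"] S[of n] by simp
    \<comment> \<open>Row \<open>f n + p\<close> is row \<open>f (n + q)\<close> and has only one
      column of value \<open>g\<close>; so both coordinates grow by \<open>p\<close>.\<close>
    then have "snd (S (n + q)) = snd (S n) + p"
      using S(2)[of "n + q"] q(2)[OF n] has_value_row_inj by simp
    then show ?thesis using q(2)[OF n] by (simp add: f_def)
  qed
  then show ?thesis
    unfolding ultimately_periodic_def S_def using q(1) by blast
qed

end
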